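(* Let $\mathcal A$ be a quantum algorithm making $Q\ge1$ queries to an oracle $[n]\times\Sigma\to\{0,1\}$. Let $M\subseteq[n]\times\Sigma$ be a non-empty set of inputs, let $H:[n]\times\Sigma\to\{0,1\}$ be an oracle, and let $\beta>0$ be such that $\widetilde w_{i,x}(H)\ge\beta$ for each $(i,x)\in M$. Then for any $k\in\mathbb N$ such that $1+\binom k2\le|M|$, there exists a subset $A_k\subseteq M$ of size at most $\binom k2$ such that for any oracle $H'\in\mathcal F_H(M\setminus A_k)$, there are at least $k$ inputs $(i,x)\in M$ with $$\widetilde w_{i,x}(H')\ge\frac{\beta}{(8Q|M|)^2}.$$
   Context: **Query model.** $\Sigma$ is a finite set and $n\in\mathbb N$. A $Q$-query quantum algorithm $\mathcal A$ acts on registers $(R_Q,R_A)$, where $R_Q$ has orthonormal basis $\{|i,x\rangle:(i,x)\in[n]\times\Sigma\}$. It starts in a fixed pure state $|\psi_0\rangle$ independent of the oracle. For $j=1,\dots,Q$ it applies the phase oracle $O_H:|i,x\rangle|a\rangle\mapsto(-1)^{H(i,x)}|i,x\rangle|a\rangle$ and then a fixed unitary $U_j$, so $|\psi^H_j\rangle=U_jO_H|\psi^H_{j-1}\rangle$ with $|\psi_0^H\rangle=|\psi_0\rangle$. **Query norm.** $\Pi_{i,x}=|i,x\rangle\langle i,x|_{R_Q}\otimes\mathbb I_{R_A}$, $\widetilde w^{\,j}_{i,x}(H)=\big\|\Pi_{i,x}|\psi^H_{j-1}\rangle\big\|_2$, and the total query norm is $\widetilde w_{i,x}(H)=\sum_{j=1}^Q\widetilde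 w^{\,j}_{i,x}(H)$. **Reprogramming.** For $X\subseteq[n]\times\Sigma$, $H\oplus X$ is the oracle obtained from $H$ by flipping its value exactly on the inputs in $X$. For $M\subseteq[n]\times\Sigma$, $\mathcal F_H(M)=\{H\oplus X:X\subseteq M\}$. *)

theory Defs
  imports "HOL-Analysis.Analysis"
begin

text \<open>
  The index set \<open>[n]\<close> and the alphabet \<open>\<Sigma>\<close> are the finite types \<open>'n\<close> and \<open>'s\<close>; \<open>'a\<close> indexes an
  orthonormal basis of \<open>R\<^sub>A\<close>. The joint space of \<open>(R\<^sub>Q, R\<^sub>A)\<close> consists of the coordinate vectors
  with respect to the basis \<open>|i,x\<rangle>|a\<rangle>\<close>, indexed by \<open>((i, x), a)\<close>. The library norm on \<open>complex ^ _\<close>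
  is the Euclidean one.
\<close>

type_synonym ('n, 's) bool_oracle = "'n \<times> 's \<Rightarrow> bool"
type_synonym ('n, 's, 'a) state = "complex ^ (('n \<times> 's) \<times> 'a)"
type_synonym ('n, 's, 'a) operator = "complex ^ (('n \<times> 's) \<times> 'a) ^ (('n \<times> 's) \<times> 'a)"

definition ket :: "'n::finite \<times> 's::finite \<Rightarrow> 'a::finite \<Rightarrow> ('n, 's, 'a) state" where
  "ket q a = axis (q, a) 1"

definition conj_transpose :: "complex ^ 'd ^ 'd \<Rightarrow> complex ^ 'd ^ 'd" where
  "conj_transpose U = (\<chi> r c. cnj (U $ c $ r))"

definition unitary :: "complex ^ 'd ^ 'd \<Rightarrow> bool" where
  "unitary U \<longleftrightarrow> conj_transpose U ** U = mat 1 \<and> U ** conj_transpose U = mat 1"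

definition phase_oracle :: "('n::finite, 's::finite) bool_oracle \<Rightarrow> ('n, 's, 'a::finite) operator" where
  "phase_oracle H = (\<chi> r c. if r = c then (-1) ^ of_bool (H (fst c)) else 0)"

lemma phase_oracle_ket: "phase_oracle H *v ket q a = ((-1) ^ of_bool (H q)) *s ket q a"
  by (auto simp: vec_eq_iff phase_oracle_def ket_def matrix_vector_mult_def axis_def
      if_distrib[where f = "\<lambda>z. _ * z"] cong: if_cong)

text \<open>The projector \<open>|i,x\<rangle>\<langle>i,x| \<otimes> I\<close>.\<close>

definition query_proj :: "'n::finite \<times> 's::finite \<Rightarrow> ('n, 's, 'a::finite) operator" where
  "query_proj q = (\<chi> r c. if r = c \<and> fst c = q then 1 else 0)"

lemma query_proj_ket: "query_proj q *v ket q' a = (if q' = q then ket q' a else 0)"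
  by (auto simp: vec_eq_iff query_proj_def ket_def matrix_vector_mult_def axis_def
      if_distrib[where f = "\<lambda>z. _ * z"] cong: if_cong)

definition query_algorithm ::
  "nat \<Rightarrow> ('n::finite, 's::finite, 'a::finite) state \<Rightarrow> (nat \<Rightarrow> ('n, 's, 'a) operator) \<Rightarrow> bool" where
  "query_algorithm Q \<psi>\<^sub>0 U \<longleftrightarrow> norm \<psi>\<^sub>0 = 1 \<and> (\<forall>j\<in>{1..Q}. unitary (U j))"

primrec state_after ::
  "('n::finite, 's::finite, 'a::finite) state \<Rightarrow> (nat \<Rightarrow> ('n, 's, 'a) operator) \<Rightarrow>
    ('n, 's) bool_oracle \<Rightarrow> nat \<Rightarrow> ('n, 's, 'a) state" where
  "state_after \<psi>\<^sub>0 U H 0 = \<psi>\<^sub>0"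
| "state_after \<psi>\<^sub>0 U H (Suc j) = U (Suc j) *v (phase_oracle H *v state_after \<psi>\<^sub>0 U H j)"

definition query_norm_at ::
  "('n::finite, 's::finite, 'a::finite) state \<Rightarrow> (nat \<Rightarrow> ('n, 's, 'a) operator) \<Rightarrow>
    nat \<Rightarrow> ('n, 's) bool_oracle \<Rightarrow> 'n \<times> 's \<Rightarrow> real" where
  "query_norm_at \<psi>\<^sub>0 U j H q = norm (query_proj q *v state_after \<psi>\<^sub>0 U H (j - 1))"

definition query_norm ::
  "nat \<Rightarrow> ('n::finite, 's::finite, 'a::finite) state \<Rightarrow> (nat \<Rightarrow> ('n, 's, 'a) operator) \<Rightarrow>
    ('n, 's) bool_oracle \<Rightarrow> 'n \<times> 's \<Rightarrow> real" where
  "query_norm Q \<psi>\<^sub>0 U H q = (\<Sum>j = 1..Q. query_norm_at \<psi>\<^sub>0 U j H q)"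

definition reprogram :: "('n, 's) bool_oracle \<Rightarrow> ('n \<times> 's) set \<Rightarrow> ('n, 's) bool_oracle" where
  "reprogram H X = (\<lambda>q. if q \<in> X then \<not> H q else H q)"

definition reprogrammings :: "('n, 's) bool_oracle \<Rightarrow> ('n \<times> 's) set \<Rightarrow> ('n, 's) bool_oracle set" where
  "reprogrammings H M = {reprogram H X | X. X \<subseteq> M}"

end

theory Submission
  imports Defs
begin

text \<open>
  For \<open>X \<subseteq> M\<close> let \<open>S X \<subseteq> M\<close> be the set of inputs that are heavy (query norm at least the threshold)
  for \<open>H \<oplus> X\<close>. Flipping light inputs hardly changes the run of the algorithm, so \<open>S X\<close> behaves like
  a certificate. If \<open>X\<close> and \<open>Y\<close> agree on \<open>S X \<inter> S Y\<close> and both vanish there, then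
  \<open>Z = (X \<inter> S X) \<union> (Y \<inter> S Y)\<close> is reached from both by flipping light inputs, so all of
  \<open>M - S X \<inter> S Y\<close> is light for \<open>H \<oplus> Z\<close>; flipping \<open>Z\<close> back makes it light for \<open>H\<close>, contradicting
  the assumption on \<open>H\<close>. Hence, as in the bound of decision tree depth by squared certificate
  complexity, greedily adding \<open>S X\<close> to \<open>A\<close> for some \<open>X\<close> disjoint from \<open>A\<close> with \<open>card (S X) < k\<close>
  lowers \<open>card (S Y - A)\<close> for every remaining such \<open>Y\<close>, and ends after adding at most
  \<open>(k - 1) + (k - 2) + \<dots> + 0\<close> inputs.
\<close>

section \<open>Norms and the coordinate action of the operators\<close>

lemma unitary_norm:
  fixes U :: "complex ^ 'd::finite ^ 'd"
  assumes "unitary U"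
  shows "norm (U *v x) = norm x"
proof -
  have norm_sq: "complex_of_real ((norm y)\<^sup>2) = (\<Sum>i\<in>UNIV. cnj (y $ i) * y $ i)" for y :: "complex ^ 'd"
  proof -
    have "(norm y)\<^sup>2 = (\<Sum>i\<in>UNIV. (norm (y $ i))\<^sup>2)"
      by (simp add: norm_vec_def L2_set_def sum_nonneg)
    then show ?thesis
      by (simp add: complex_norm_square mult.commute del: of_real_power)
  qed
  have gram: "(\<Sum>i\<in>UNIV. cnj (U $ i $ c) * U $ i $ d) = (if c = d then 1 else 0)" for c d
  proof -
    have "(conj_transpose U ** U) $ c $ d = mat 1 $ c $ d"
      using assms by (simp add: unitary_def)
    then show ?thesis
      by (simp add: matrix_matrix_mult_def conj_transpose_def mat_def)
  qed
  have "complex_of_real ((norm (U *v x))\<^sup>2)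
      = (\<Sum>i\<in>UNIV. \<Sum>c\<in>UNIV. \<Sum>d\<in>UNIV. cnj (x $ c) * x $ d * (cnj (U $ i $ c) * U $ i $ d))"
    unfolding norm_sq
    unfolding matrix_vector_mult_def vec_lambda_beta cnj_sum sum_product complex_cnj_mult
    by (simp only: mult_ac)
  also have "\<dots> = (\<Sum>c\<in>UNIV. \<Sum>i\<in>UNIV. \<Sum>d\<in>UNIV. cnj (x $ c) * x $ d * (cnj (U $ i $ c) * U $ i $ d))"
    by (rule sum.swap)
  also have "\<dots> = (\<Sum>c\<in>UNIV. \<Sum>d\<in>UNIV. \<Sum>i\<in>UNIV. cnj (x $ c) * x $ d * (cnj (U $ i $ c) * U $ i $ d))"
    by (intro sum.cong refl sum.swap)
  also have "\<dots> = (\<Sum>c\<in>UNIV. \<Sum>d\<in>UNIV. cnj (x $ c) * x $ d * (if c = d then 1 else 0))"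
    by (simp add: gram flip: sum_distrib_left)
  also have "\<dots> = complex_of_real ((norm x)\<^sup>2)"
    unfolding norm_sq by (simp add: if_distrib[where f = "\<lambda>z. _ * z"] cong: if_cong)
  finally have "(norm (U *v x))\<^sup>2 = (norm x)\<^sup>2"
    using of_real_eq_iff by blast
  then show ?thesis
    by simp
qed

lemma phase_oracle_nth: "(phase_oracle H *v x) $ i = (if H (fst i) then - x $ i else x $ i)"
  by (simp add: phase_oracle_def matrix_vector_mult_def if_distrib[where f = "\<lambda>z. z * _"] cong: if_cong)

lemma query_proj_nth: "(query_proj q *v x) $ i = (if fst i = q then x $ i else 0)"
  by (simp add: query_proj_def matrix_vector_mult_def if_distrib[where f = "\<lambda>z. z * _"]
      flip: if_if_eq_conj cong: if_cong)

lemma norm_phase_oracle: "norm (phase_oracle H *v x) = norm x"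
  by (simp add: norm_vec_def L2_set_def phase_oracle_nth if_distrib[where f = norm] cong: if_cong)

lemma norm_query_proj_le: "norm (query_proj q *v x) \<le> norm x"
  by (rule norm_le_componentwise_cart) (simp add: query_proj_nth)

text \<open>The difference of the two oracles is diagonal with entries 0, 2 or -2, and vanishes off
  \<open>Z\<close>.\<close>

lemma norm_phase_oracle_diff:
  assumes "\<And>q. q \<notin> Z \<Longrightarrow> G q = G' q"
  shows "norm (phase_oracle G' *v x - phase_oracle G *v x)
    \<le> 2 * (\<Sum>q\<in>Z. norm (query_proj q *v x))"
proof -
  have "norm (phase_oracle G' *v x - phase_oracle G *v x)
      \<le> norm (2 *\<^sub>R (\<Sum>q\<in>Z. query_proj q *v x))"
    using assms
    by (intro norm_le_componentwise_cart)
      (auto simp: phase_oracle_nth query_proj_nth norm_mult simp flip: mult_2)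
  also have "\<dots> \<le> 2 * (\<Sum>q\<in>Z. norm (query_proj q *v x))"
    using norm_sum by (simp del: sum_component)
  finally show ?thesis .
qed

section \<open>Stability of query norms under reprogramming\<close>

lemma query_norm_nonneg: "0 \<le> query_norm Q \<psi>\<^sub>0 U H q"
  by (simp add: query_norm_def query_norm_at_def sum_nonneg)

text \<open>Counting from zero, one more query appends one summand, which suits induction on the
  number of queries.\<close>

lemma query_norm_eq:
  "query_norm Q \<psi>\<^sub>0 U H q = (\<Sum>i<Q. norm (query_proj q *v state_after \<psi>\<^sub>0 U H i))"
  unfolding query_norm_def query_norm_at_def
  by (rule sum.reindex_bij_witness[of _ Suc "\<lambda>j. j - 1"]) auto

text \<open>Hybrid argument: earlier deviation is carried along isometrically, and each query adds
  at most twice the norm that the run with \<open>G\<close> puts on \<open>Z\<close>.\<close>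

lemma state_after_diff_le:
  assumes "\<And>j. j \<in> {1..t} \<Longrightarrow> unitary (U j)" and "\<And>q. q \<notin> Z \<Longrightarrow> G q = G' q"
  shows "norm (state_after \<psi>\<^sub>0 U G' t - state_after \<psi>\<^sub>0 U G t) \<le> 2 * (\<Sum>q\<in>Z. query_norm t \<psi>\<^sub>0 U G q)"
  using assms(1)
proof (induction t)
  case 0
  then show ?case by (simp add: query_norm_def)
next
  case (Suc t)
  let ?a = "state_after \<psi>\<^sub>0 U G' t" and ?b = "state_after \<psi>\<^sub>0 U G t"
  have "norm (state_after \<psi>\<^sub>0 U G' (Suc t) - state_after \<psi>\<^sub>0 U G (Suc t))
      = norm (phase_oracle G' *v ?a - phase_oracle G *v ?b)"
    using Suc.prems by (simp add: unitary_norm flip: matrix_vector_mult_diff_distrib)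
  \<comment> \<open>The intermediate vector \<open>phase_oracle G' *v ?b\<close> separates old
    deviation from new.\<close>
  also have "phase_oracle G' *v ?a - phase_oracle G *v ?b
      = phase_oracle G' *v (?a - ?b) + (phase_oracle G' *v ?b - phase_oracle G *v ?b)"
    by (simp add: matrix_vector_mult_diff_distrib)
  also have "norm \<dots> \<le> norm (?a - ?b) + norm (phase_oracle G' *v ?b - phase_oracle G *v ?b)"
    using norm_triangle_ineq norm_phase_oracle by metis
  also have "\<dots> \<le> 2 * (\<Sum>q\<in>Z. query_norm t \<psi>\<^sub>0 U G q) + 2 * (\<Sum>q\<in>Z. norm (query_proj q *v ?b))"
    using Suc by (intro add_mono norm_phase_oracle_diff assms(2)) auto
  also have "\<dots> = 2 * (\<Sum>q\<in>Z. query_norm (Suc t) \<psi>\<^sub>0 U G q)"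
    by (simp add: query_norm_eq sum.distrib)
  finally show ?case .
qed

lemma query_norm_diff_le:
  assumes "query_algorithm Q \<psi>\<^sub>0 U" and "\<And>q. q \<notin> Z \<Longrightarrow> G q = G' q"
  shows "query_norm Q \<psi>\<^sub>0 U G' q
    \<le> query_norm Q \<psi>\<^sub>0 U G q + 2 * real Q * (\<Sum>z\<in>Z. query_norm Q \<psi>\<^sub>0 U G z)"
proof -
  let ?s = "\<Sum>z\<in>Z. query_norm Q \<psi>\<^sub>0 U G z"
  have "norm (query_proj q *v state_after \<psi>\<^sub>0 U G' i)
      \<le> norm (query_proj q *v state_after \<psi>\<^sub>0 U G i) + 2 * ?s" if "i < Q" for i
  proof -
    let ?a = "state_after \<psi>\<^sub>0 U G' i" and ?b = "state_after \<psi>\<^sub>0 U G i"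
    have "norm (query_proj q *v ?a) - norm (query_proj q *v ?b) \<le> norm (query_proj q *v (?a - ?b))"
      by (simp add: matrix_vector_mult_diff_distrib norm_triangle_ineq2)
    also have "\<dots> \<le> norm (?a - ?b)"
      by (rule norm_query_proj_le)
    also have "\<dots> \<le> 2 * (\<Sum>z\<in>Z. query_norm i \<psi>\<^sub>0 U G z)"
      using assms that by (intro state_after_diff_le) (auto simp: query_algorithm_def)
    also have "\<dots> \<le> 2 * ?s"
      using that unfolding query_norm_eq
      by (intro mult_left_mono sum_mono sum_mono2) auto
    finally show ?thesis by simp
  qed
  then have "query_norm Q \<psi>\<^sub>0 U G' q
      \<le> (\<Sum>i<Q. norm (query_proj q *v state_after \<psi>\<^sub>0 U G i) + 2 * ?s)"
    unfolding query_norm_eq[of Q \<psi>\<^sub>0 U G'] by (intro sum_mono) auto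
  then show ?thesis
    by (simp add: sum.distrib query_norm_eq mult_ac)
qed

text \<open>Flips within the light set \<open>L\<close> amplify \<open>t\<close> by at most 1 + 2 Q
  |M|, hence 3 Q |M|. Using |M| rather than |L| gives every application the same factor.\<close>

lemma query_norm_flip_light:
  assumes "query_algorithm Q \<psi>\<^sub>0 U" and "Q \<ge> 1"
    and "L \<subseteq> M" and "\<And>q. q \<notin> L \<Longrightarrow> G q = G' q"
    and light: "\<And>q. q \<in> L \<Longrightarrow> query_norm Q \<psi>\<^sub>0 U G q \<le> t"
    and "q \<in> L"
  shows "query_norm Q \<psi>\<^sub>0 U G' q \<le> 3 * real Q * real (card M) * t"
proof -
  have t: "0 \<le> t"
    using light[OF \<open>q \<in> L\<close>] query_norm_nonneg order_trans by blast
  have card: "card L \<le> card M"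
    using assms by (intro card_mono) auto
  have "1 \<le> Q * card M"
    using assms by (auto simp: Suc_le_eq card_gt_0_iff)
  then have Qm: "1 \<le> real Q * real (card M)"
    by (metis of_nat_1 of_nat_le_iff of_nat_mult)
  have "(\<Sum>z\<in>L. query_norm Q \<psi>\<^sub>0 U G z) \<le> real (card L) * t"
    using light by (rule sum_bounded_above)
  also have "\<dots> \<le> real (card M) * t"
    using card t by (intro mult_right_mono) auto
  finally have "2 * real Q * (\<Sum>z\<in>L. query_norm Q \<psi>\<^sub>0 U G z) \<le> 2 * real Q * (real (card M) * t)"
    by (intro mult_left_mono) auto
  with query_norm_diff_le[of Q \<psi>\<^sub>0 U L G G' q] light[OF \<open>q \<in> L\<close>] assms(1,4)
  have "query_norm Q \<psi>\<^sub>0 U G' q \<le> t + 2 * (real Q * real (card M)) * t"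
    by (simp add: mult_ac)
  also have "\<dots> \<le> 3 * real Q * real (card M) * t"
    using mult_right_mono[OF Qm t] by (simp add: algebra_simps)
  finally show ?thesis .
qed

section \<open>Combinatorics of the greedy choice\<close>

lemma greedy_hitting_set:
  fixes S :: "'b set \<Rightarrow> 'b set"
  assumes "finite M" and S: "\<And>X. S X \<subseteq> M"
    and conflict: "\<And>X Y. \<lbrakk>X \<subseteq> M; Y \<subseteq> M; card (S X) < k; card (S Y) < k; Y \<inter> S X = {}\<rbrakk>
      \<Longrightarrow> X \<inter> S X \<inter> S Y \<noteq> {}"
  shows "\<exists>A\<subseteq>M. card A \<le> k choose 2 \<and> (\<forall>X\<subseteq>M - A. k \<le> card (S X))"
proof -
  have fin: "finite (S X)" for X
    using S \<open>finite M\<close> finite_subset by blast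
  \<comment> \<open>Invariant after \<open>t\<close> rounds: \<open>(k - t) choose 2\<close> is the
    budget left, and each remaining small set has fewer than \<open>k - t\<close> elements outside
    \<open>A\<close>. At \<open>t = k\<close> none can remain.\<close>
  have "\<exists>A\<subseteq>M. card A + ((k - t) choose 2) \<le> k choose 2 \<and>
      (\<forall>Y\<subseteq>M - A. card (S Y) < k \<longrightarrow> card (S Y - A) + t < k)" if "t \<le> k" for t
    using that
  proof (induction t)
    case 0
    then show ?case by (intro exI[of _ "{}"]) auto
  next
    case (Suc t)
    then obtain A where A: "A \<subseteq> M" "card A + ((k - t) choose 2) \<le> k choose 2"
      and small: "\<And>Y. \<lbrakk>Y \<subseteq> M - A; card (S Y) < k\<rbrakk> \<Longrightarrow> card (S Y - A) + t < k"
      by auto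
    \<comment> \<open>Pascal's rule: this round may spend \<open>k - Suc t\<close> inputs, the most
      that \<open>S X - A\<close> can contain.\<close>
    have choose: "(k - t) choose 2 = ((k - Suc t) choose 2) + (k - Suc t)"
      using Suc.prems by (simp add: Suc_diff_Suc[symmetric] numeral_2_eq_2)
    show ?case
    proof (cases "\<exists>X\<subseteq>M - A. card (S X) < k")
      case False
      then show ?thesis
        using A choose by (intro exI[of _ A]) auto
    next
      case True
      then obtain X where X: "X \<subseteq> M - A" "card (S X) < k"
        by blast
      have "card (A \<union> S X) \<le> card A + card (S X - A)"
        by (metis Un_Diff_cancel card_Un_le)
      then have "card (A \<union> S X) + ((k - Suc t) choose 2) \<le> k choose 2"
        using small[OF X] choose A(2) by linarith
      moreover have "card (S Y - (A \<union> S X)) + Suc t < k"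
        if Y: "Y \<subseteq> M - (A \<union> S X)" "card (S Y) < k" for Y
      proof -
        \<comment> \<open>The common input lies in \<open>X\<close>, hence outside \<open>A\<close>,
          so adding \<open>S X\<close> shrinks \<open>S Y - A\<close> strictly.\<close>
        have "X \<inter> S X \<inter> S Y \<noteq> {}"
          using X Y by (intro conflict) auto
        then have "S Y - (A \<union> S X) \<subset> S Y - A"
          using X(1) by blast
        then have "card (S Y - (A \<union> S X)) < card (S Y - A)"
          using fin by (intro psubset_card_mono) auto
        moreover have "card (S Y - A) + t < k"
          using Y by (intro small) auto
        ultimately show ?thesis by linarith
      qed
      ultimately show ?thesis
        using A(1) S by (intro exI[of _ "A \<union> S X"]) auto
    qed
  qed
  from this[of k] obtain A where "A \<subseteq> M" "card A \<le> k choose 2"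
    and "\<forall>Y\<subseteq>M - A. \<not> card (S Y) < k"
    by auto
  then show ?thesis
    using not_less by blast
qed

section \<open>From light flips to the conflict property\<close>

theorem lemma4p3:
  fixes Q :: nat
    and \<psi>\<^sub>0 :: "('n::finite, 's::finite, 'a::finite) state"
    and U :: "nat \<Rightarrow> ('n, 's, 'a) operator"
    and M :: "('n \<times> 's) set"
    and H :: "('n, 's) bool_oracle"
    and \<beta> :: real
    and k :: nat
  assumes "query_algorithm Q \<psi>\<^sub>0 U"
    and "Q \<ge> 1"
    and "M \<noteq> {}"
    and "\<beta> > 0"
    and "\<forall>q\<in>M. query_norm Q \<psi>\<^sub>0 U H q \<ge> \<beta>"
    and "1 + (k choose 2) \<le> card M"
  shows "\<exists>A\<^sub>k. A\<^sub>k \<subseteq> M \<and> card A\<^sub>k \<le> k choose 2 \<and>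
    (\<forall>H'\<in>reprogrammings H (M - A\<^sub>k).
      card {q \<in> M. query_norm Q \<psi>\<^sub>0 U H' q \<ge> \<beta> / (8 * real Q * real (card M))\<^sup>2} \<ge> k)"
proof -
  let ?w = "query_norm Q \<psi>\<^sub>0 U" and ?c = "3 * real Q * real (card M)"
  define \<tau> where "\<tau> = \<beta> / (8 * real Q * real (card M))\<^sup>2"
  define S where "S X = {q \<in> M. ?w (reprogram H X) q \<ge> \<tau>}" for X
  have Q: "real Q > 0" and m: "real (card M) > 0"
    using assms(2,3) by (auto simp: card_gt_0_iff)
  \<comment> \<open>Two flips, to \<open>Z\<close> and back to \<open>H\<close>, cost a factor
    \<open>?c\<close> each; 3 * 3 < 8 * 8 makes the bound strict.\<close>
  have \<tau>_bound: "?c * (?c * \<tau>) < \<beta>"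
    using Q m \<open>\<beta> > 0\<close> unfolding \<tau>_def by (simp add: field_simps power2_eq_square)
  \<comment> \<open>This makes every \<open>S X\<close> with fewer than \<open>k\<close> elements
    miss some input of \<open>M\<close>.\<close>
  have k: "k \<le> card M"
  proof -
    have "k \<le> 1 + (k choose 2)"
    proof (induction k)
      case (Suc k)
      then show ?case by (cases k) (auto simp: numeral_2_eq_2)
    qed simp
    with assms(6) show ?thesis by linarith
  qed
  note flip = query_norm_flip_light[OF assms(1,2)]
  have S_sub: "S X \<subseteq> M" for X
    by (auto simp: S_def)
  have conflict: "X \<inter> S X \<inter> S Y \<noteq> {}"
    if X: "X \<subseteq> M" "card (S X) < k" and Y: "Y \<subseteq> M" and disj: "Y \<inter> S X = {}" for X Y
  proof
    assume empty: "X \<inter> S X \<inter> S Y = {}"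
    define Z where "Z = (X \<inter> S X) \<union> (Y \<inter> S Y)"
    \<comment> \<open>If \<open>Z\<close> agrees with \<open>W\<close> on \<open>S W\<close>,
      passing from \<open>W\<close> to \<open>Z\<close> flips only inputs light for
      \<open>reprogram H W\<close>.\<close>
    have near: "?w (reprogram H Z) q \<le> ?c * \<tau>"
      if "W \<subseteq> M" "Z \<inter> S W = W \<inter> S W" "q \<in> M - S W" for W q
    proof (rule flip[where L = "M - S W" and G = "reprogram H W"])
      show "reprogram H W p = reprogram H Z p" if "p \<notin> M - S W" for p
        using that \<open>W \<subseteq> M\<close> \<open>Z \<inter> S W = W \<inter> S W\<close> X(1) Y by (auto simp: reprogram_def Z_def)
      show "?w (reprogram H W) p \<le> \<tau>" if "p \<in> M - S W" for p
        using that by (auto simp: S_def)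
    qed (use that in auto)
    \<comment> \<open>\<open>Z\<close> agrees with \<open>X\<close> on \<open>S X\<close> by
      \<open>disj\<close>, and with \<open>Y\<close> on \<open>S Y\<close> by \<open>empty\<close>;
      \<open>q\<close> lies outside one of these two sets.\<close>
    have light: "?w (reprogram H Z) q \<le> ?c * \<tau>" if "q \<in> M - S X \<inter> S Y" for q
      using near[of X q] near[of Y q] X(1) Y disj empty that by (auto simp: Z_def)
    have "S X \<noteq> M"
      using X(2) k by auto
    then obtain q where q: "q \<in> M - S X \<inter> S Y"
      using S_sub[of X] by blast
    \<comment> \<open>\<open>Z\<close> avoids \<open>S X \<inter> S Y\<close>, so undoing it flips
      only inputs just shown light.\<close>
    have "?w H q \<le> ?c * (?c * \<tau>)"
    proof (rule flip[where L = "M - S X \<inter> S Y" and G = "reprogram H Z"])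
      show "reprogram H Z p = H p" if "p \<notin> M - S X \<inter> S Y" for p
        using that X(1) Y disj empty by (auto simp: reprogram_def Z_def)
    qed (use light q in auto)
    moreover have "\<beta> \<le> ?w H q"
      using assms(5) q by blast
    ultimately show False
      using \<tau>_bound by linarith
  qed
  have "\<exists>A\<subseteq>M. card A \<le> k choose 2 \<and> (\<forall>X\<subseteq>M - A. k \<le> card (S X))"
    using conflict S_sub by (intro greedy_hitting_set) auto
  then show ?thesis
    unfolding reprogrammings_def S_def \<tau>_def by blast
qed

end
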